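(* Let $SO(3)$ act on the unit sphere $S^2\subset\mathbb{R}^3$. For every finite set $W\subset S^2$ there is a precoloring $c:S^2\setminus W\to\{R,B\}$ such that no extension of $c$ to a coloring $S^2\to\{R,B\}$ is $SO(3)$-distinguishing; in particular $P(W,SO(3))$ fails for every finite $W$. Assuming the axiom of choice, the same holds for every countable set $W\subset S^2$.
   Context: A coloring $c:S^2\to\{R,B\}$ is $SO(3)$-distinguishing if the only $\gamma\in SO(3)$ with $c\circ\gamma=c$ is the identity. For $W\subset S^2$ with trivial pointwise stabilizer in $SO(3)$, $P(W,SO(3))$ holds if every precoloring $S^2\setminus W\to\{R,B\}$ extends to an $SO(3)$-distinguishing coloring of $S^2$. *)

theory Defs
  imports "HOL-Analysis.Analysis"
begin

datatype colour = R | B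

definition sphere2 :: "(real^3) set" where
  "sphere2 = {x. norm x = 1}"

definition SO3 :: "(real^3^3) set" where
  "SO3 = {A. orthogonal_matrix A \<and> det A = 1}"

text \<open>A coloring of the sphere is a function on real^3; only its values on sphere2 matter.
  It is SO(3)-distinguishing if the only rotation preserving it (on the sphere) is the identity.\<close>
definition SO3_distinguishing :: "(real^3 \<Rightarrow> colour) \<Rightarrow> bool" where
  "SO3_distinguishing c \<longleftrightarrow>
     (\<forall>A\<in>SO3. (\<forall>x\<in>sphere2. c (A *v x) = c x) \<longrightarrow> A = mat 1)"

definition trivial_pointwise_stabilizer :: "(real^3) set \<Rightarrow> bool" where
  "trivial_pointwise_stabilizer W \<longleftrightarrow>
     (\<forall>A\<in>SO3. (\<forall>w\<in>W. A *v w = w) \<longrightarrow> A = mat 1)"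

text \<open>A precoloring of sphere2 - W is a function whose values on sphere2 - W matter;
  f extends it if f agrees with it on sphere2 - W.\<close>
definition extends_precol :: "(real^3 \<Rightarrow> colour) \<Rightarrow> (real^3) set \<Rightarrow> (real^3 \<Rightarrow> colour) \<Rightarrow> bool" where
  "extends_precol f W c \<longleftrightarrow> (\<forall>x\<in>sphere2 - W. f x = c x)"

definition P_SO3 :: "(real^3) set \<Rightarrow> bool" where
  "P_SO3 W \<longleftrightarrow> W \<subseteq> sphere2 \<and> trivial_pointwise_stabilizer W \<and>
     (\<forall>c. \<exists>f. extends_precol f W c \<and> SO3_distinguishing f)"

end

theory Submission
  imports Defs
begin

text \<open>
  Attach to every subset \<open>S\<close> of \<open>W\<close> a half turn \<open>h\<^sub>S\<close> of the sphere such that these half turns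
  generate a free product of groups of order two in which no nontrivial reduced word maps a point
  of \<open>W\<close> into \<open>W\<close>. Give the point \<open>g w\<close>, for a nontrivial reduced word \<open>g\<close> whose rightmost letter
  is \<open>h\<^sub>S\<close>, the colour red iff \<open>w \<in> S\<close>. An extension whose red points in \<open>W\<close> form the set \<open>S\<close>
  is then invariant under \<open>h\<^sub>S\<close>, since multiplying \<open>g\<close> on the left by \<open>h\<^sub>S\<close> changes its rightmost
  letter only when passing through \<open>W\<close> itself.

  A set of continuum many such half turns exists by maximality: if a set \<open>U\<close> of axes with the
  required freeness has fewer than continuum many elements, choose a unit vector \<open>n\<close> which is
  fixed by no nontrivial reduced word in \<open>U\<close> and is not plus or minus an image of a point of \<open>W\<close>,
  and look for a new axis on the great circle orthogonal to \<open>n\<close>, spanned by \<open>a + t b\<close> with \<open>a, b\<close>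
  orthonormal. For each word involving the new axis, the bad parameters \<open>t\<close> are the roots of
  polynomials. They do not all vanish identically: at \<open>t = \<i>\<close> the vector \<open>a + \<i> b\<close> is isotropic, the
  half turn degenerates (after clearing the denominator \<open>1 + t\<^sup>2\<close>) to a map of rank one, and the
  value of the word is a product of inner products which are nonzero by the choice of \<open>n\<close>.
\<close>

subsection \<open>Sets of cardinality at most a given infinite one\<close>

text \<open>The summand \<^typ>\<open>nat\<close> makes the bound infinite even when \<open>U\<close> is finite.\<close>
definition small :: "'a set \<Rightarrow> 'b set \<Rightarrow> bool" where
  "small U X \<longleftrightarrow> X \<lesssim> U <+> (UNIV :: nat set)"

lemma small_subset: "small U Y \<Longrightarrow> X \<subseteq> Y \<Longrightarrow> small U X"
  unfolding small_def by (meson lepoll_trans subset_imp_lepoll)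

lemma small_image: "small U X \<Longrightarrow> small U (f ` X)"
  unfolding small_def by (meson image_lepoll lepoll_trans)

lemma small_countable: "countable X \<Longrightarrow> small U X"
proof -
  assume "countable X"
  then have "X \<lesssim> (UNIV :: nat set)" by (auto simp: lepoll_def countable_def)
  also have "\<dots> \<lesssim> U <+> (UNIV :: nat set)"
    unfolding lepoll_def by (rule exI[of _ Inr]) auto
  finally show ?thesis by (simp add: small_def)
qed

lemma small_self: "small U U"
  unfolding small_def lepoll_def by (rule exI[of _ Inl]) auto

text \<open>The bound \<open>U <+> UNIV\<close> is infinite and therefore absorbs its own
  square.\<close>

lemma small_UN:
  assumes "small U I" "\<And>i. i \<in> I \<Longrightarrow> small U (F i)"
  shows "small U (\<Union>i\<in>I. F i)"
  using assms card_of_UNION_ordLeq_infinite[of "U <+> (UNIV :: nat set)" I F]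
  by (simp add: small_def lepoll_def card_of_ordLeq finite_Plus_iff)

lemma small_Un: "small U X \<Longrightarrow> small U Y \<Longrightarrow> small U (X \<union> Y)"
  using small_UN[of U "UNIV" "\<lambda>i. if i then X else Y"] small_countable[of "UNIV :: bool set" U]
  by (simp add: UNIV_bool Un_commute)

lemma small_Times:
  assumes "small U X" "small U Y"
  shows "small U (X \<times> Y)"
proof -
  have "X \<times> Y = (\<Union>x\<in>X. Pair x ` Y)" by auto
  then show ?thesis using assms by (auto intro: small_UN small_image)
qed

lemma small_lists:
  assumes "small U X"
  shows "small U (lists X)"
proof -
  have "small U {xs \<in> lists X. length xs = n}" for n
  proof (induction n)
    case 0
    have "{xs \<in> lists X. length xs = 0} = {[]}" by auto
    then show ?case by (simp add: small_countable)
  next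
    case (Suc n)
    have "{xs \<in> lists X. length xs = Suc n}
        \<subseteq> (\<lambda>(x, xs). x # xs) ` (X \<times> {xs \<in> lists X. length xs = n})"
      by (auto simp: length_Suc_conv image_iff)
    then show ?case
      using small_image[OF small_Times[OF assms Suc]] small_subset by blast
  qed
  then have "small U (\<Union>n. {xs \<in> lists X. length xs = n})"
    by (intro small_UN) (auto intro: small_countable)
  then show ?thesis by (rule small_subset) auto
qed

text \<open>For infinite \<open>U\<close> the summand \<open>nat\<close> is absorbed.
  Contrapositively, a small set cannot exhaust the reals while \<open>U\<close> has less than
  continuum size.\<close>

lemma small_real_imp_lepoll:
  assumes "small U (UNIV :: real set)"
  shows "(UNIV :: real set) \<lesssim> U"
proof (cases "countable U")
  case True
  then have "countable (U <+> (UNIV :: nat set))" by (simp add: countable_Plus)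
  then have "countable (UNIV :: real set)"
    using assms unfolding small_def by (meson countable_lepoll)
  then show ?thesis using uncountable_UNIV_real by contradiction
next
  case False
  then have "infinite U" using countable_finite by blast
  then have "(UNIV :: nat set) \<lesssim> U" by (simp add: infinite_le_lepoll)
  then have "U <+> (UNIV :: nat set) \<approx> U"
    using card_of_Plus_infinite1[OF \<open>infinite U\<close>, of "UNIV :: nat set"]
    by (simp add: lepoll_def eqpoll_def card_of_ordLeq card_of_ordIso)
  then show ?thesis
    using assms unfolding small_def by (meson lepoll_trans eqpoll_imp_lepoll)
qed

subsection \<open>Half turns and words\<close>

unbundle cross3_syntax

definition half_turn :: "real^3 \<Rightarrow> real^3 \<Rightarrow> real^3" where
  "half_turn u x = (2 * (u \<bullet> x)) *\<^sub>R u - x"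

lemma linear_half_turn: "linear (half_turn u)"
  by (rule linearI) (auto simp: half_turn_def inner_add_right algebra_simps)

lemma half_turn_involution:
  assumes "norm u = 1"
  shows "half_turn u (half_turn u x) = x"
  using assms by (simp add: half_turn_def inner_diff_right norm_eq_1 algebra_simps scaleR_2)

lemma inner_half_turn:
  assumes "norm u = 1"
  shows "half_turn u x \<bullet> half_turn u y = x \<bullet> y"
  using assms by (simp add: half_turn_def norm_eq_1 inner_simps inner_commute algebra_simps)

lemma matrix_half_turn_in_SO3:
  assumes "norm u = 1"
  shows "matrix (half_turn u) \<in> SO3"
proof -
  have orth: "orthogonal_transformation (half_turn u)"
    using assms by (simp add: orthogonal_transformation_def linear_half_turn inner_half_turn)
  have "u \<bullet> u = 1" using assms by (simp add: norm_eq_1)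
  then have s: "u$1 * u$1 + u$2 * u$2 + u$3 * u$3 = 1"
    by (simp add: inner_vec_def sum_3)
  have "det (matrix (half_turn u)) = 2 * (u$1 * u$1 + u$2 * u$2 + u$3 * u$3) - 1"
    by (simp add: det_3 matrix_def half_turn_def inner_axis axis_def inner_vec_def sum_3) (simp add: algebra_simps)
  with s orth show ?thesis
    by (simp add: SO3_def orthogonal_transformation_matrix)
qed

lemma matrix_half_turn_apply: "matrix (half_turn u) *v x = half_turn u x"
  by (simp add: linear_half_turn matrix_works)

text \<open>Relies on determinant 1; an orientation-reversing isometry would change the
  sign.\<close>

lemma cross_half_turn:
  assumes "norm u = 1"
  shows "half_turn u x \<times> half_turn u y = half_turn u (x \<times> y)"
proof -
  have "rotation_matrix (matrix (half_turn u))"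
    using matrix_half_turn_in_SO3[OF assms] by (simp add: SO3_def rotation_matrix_def)
  from cross_rotation_matrix[OF this] show ?thesis
    by (simp add: matrix_half_turn_apply)
qed

lemma matrix_half_turn_ne_id:
  assumes "norm u = 1"
  shows "matrix (half_turn u) \<noteq> mat 1"
proof
  assume "matrix (half_turn u) = mat 1"
  then have *: "half_turn u x = x" for x
    by (metis matrix_half_turn_apply matrix_vector_mul_lid)
  obtain x where x: "x \<noteq> 0" "orthogonal u x"
    using orthogonal_to_vector_exists[of u] by (auto simp: orthogonal_commute)
  have "half_turn u x = - x"
    using x by (simp add: half_turn_def orthogonal_def)
  with *[of x] have "x + x = 0"
    by (metis add.left_inverse)
  then have "2 *\<^sub>R x = 0"
    by (simp add: scaleR_2)
  with x show False by simp
qed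

definition word_act :: "(real^3) list \<Rightarrow> real^3 \<Rightarrow> real^3" where
  "word_act us = foldr half_turn us"

lemma word_act_simps [simp]:
  "word_act [] x = x" "word_act (u # us) x = half_turn u (word_act us x)"
  by (simp_all add: word_act_def)

lemma linear_word_act: "linear (word_act us)"
  using linear_half_turn by (induction us) (auto simp: word_act_def linear_compose linear_id)

lemma inner_word_act:
  assumes "us \<in> lists sphere2"
  shows "word_act us x \<bullet> word_act us y = x \<bullet> y"
  using assms by (induction us) (auto simp: sphere2_def inner_half_turn)

lemma norm_word_act:
  assumes "us \<in> lists sphere2"
  shows "norm (word_act us x) = norm x"
  using inner_word_act[OF assms] by (simp add: norm_eq_sqrt_inner)

lemma cross_word_act:
  assumes "us \<in> lists sphere2"
  shows "word_act us x \<times> word_act us y = word_act us (x \<times> y)"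
  using assms by (induction us) (auto simp: sphere2_def cross_half_turn)

section \<open>Orthonormal frames and vectors fixed by a rotation\<close>

lemma orthonormal_frame_exists:
  fixes n :: "real^3"
  assumes "norm n = 1"
  obtains a b where "norm a = 1" "norm b = 1" "a \<bullet> b = 0" "a \<times> b = n"
proof -
  obtain x where x: "x \<noteq> 0" "orthogonal n x"
    using orthogonal_to_vector_exists[of n] by (auto simp: orthogonal_commute)
  define a where "a = sgn x"
  have a: "norm a = 1" "n \<bullet> a = 0"
    using x by (simp_all add: a_def norm_sgn sgn_div_norm orthogonal_def)
  have ab: "a \<times> (n \<times> a) = n"
    using a by (simp add: Lagrange norm_eq_1 inner_commute)
  have "(norm (n \<times> a))\<^sup>2 = 1"
    using norm_cross_dot[of n a] a assms by simp
  then have "norm (n \<times> a) = 1"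
    by (metis norm_ge_zero power2_eq_1_iff le_minus_one_simps(3))
  with a ab show ?thesis by (intro that[of a "n \<times> a"]) (auto simp: dot_cross_self)
qed

lemma frame_expansion:
  fixes a b x :: "real^3"
  assumes "norm a = 1" "norm b = 1" "a \<bullet> b = 0"
  shows "x = (a \<bullet> x) *\<^sub>R a + (b \<bullet> x) *\<^sub>R b + ((a \<times> b) \<bullet> x) *\<^sub>R (a \<times> b)"
proof -
  define d where "d = x - ((a \<bullet> x) *\<^sub>R a + (b \<bullet> x) *\<^sub>R b + ((a \<times> b) \<bullet> x) *\<^sub>R (a \<times> b))"
  have n: "norm (a \<times> b) = 1"
    using norm_cross_dot[of a b] assms
    by (simp add: power2_eq_1_iff) (smt (verit) norm_ge_zero)
  have [simp]: "a \<bullet> a = 1" "b \<bullet> b = 1" "(a \<times> b) \<bullet> (a \<times> b) = 1" "b \<bullet> a = 0"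
    using assms n by (simp_all add: norm_eq_1 inner_commute)
  have d: "a \<bullet> d = 0" "b \<bullet> d = 0" "(a \<times> b) \<bullet> d = 0"
    using assms(3)
    by (simp_all add: d_def inner_simps dot_cross_self inner_commute[of "a \<times> b" a])
  have "d \<times> (a \<times> b) = 0"
    using d by (simp add: Lagrange inner_commute)
  then have "(a \<times> b) \<times> d = 0"
    by (metis cross_skew neg_equal_0_iff_equal)
  with d n have "d = 0"
    by (metis norm_and_cross_eq_0 norm_zero zero_neq_one)
  then show ?thesis by (simp add: d_def)
qed

text \<open>The isotropic vector \<open>a + \<i> b\<close> is orthogonal to its image under a rotation only if the
  rotation preserves the complex line it spans.\<close>
lemma isotropic_inner_zero_imp_fixed:
  assumes us: "us \<in> lists sphere2"
    and ab: "norm a = 1" "norm b = 1" "a \<bullet> b = 0"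
    and re: "a \<bullet> word_act us a = b \<bullet> word_act us b"
    and im: "a \<bullet> word_act us b = - (b \<bullet> word_act us a)"
  shows "word_act us (a \<times> b) = a \<times> b"
proof -
  let ?A = "word_act us a" and ?B = "word_act us b"
  define \<alpha> \<beta> p q where defs: "\<alpha> = a \<bullet> ?A" "\<beta> = b \<bullet> ?A" "p = (a \<times> b) \<bullet> ?A" "q = (a \<times> b) \<bullet> ?B"
  have A: "?A = \<alpha> *\<^sub>R a + \<beta> *\<^sub>R b + p *\<^sub>R (a \<times> b)"
    unfolding defs by (rule frame_expansion[OF ab])
  have B: "?B = (- \<beta>) *\<^sub>R a + \<alpha> *\<^sub>R b + q *\<^sub>R (a \<times> b)"
    unfolding defs using frame_expansion[OF ab, of ?B] re im by simp
  have inner_A: "?A \<bullet> y = \<alpha> * (a \<bullet> y) + \<beta> * (b \<bullet> y) + p * ((a \<times> b) \<bullet> y)" for y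
    by (subst A) (simp add: inner_simps)
  have inner_B: "?B \<bullet> y = - \<beta> * (a \<bullet> y) + \<alpha> * (b \<bullet> y) + q * ((a \<times> b) \<bullet> y)" for y
    by (subst B) (simp add: inner_simps)
  have "a \<bullet> ?B = - \<beta>" "b \<bullet> ?B = \<alpha>"
    using re im by (simp_all add: defs)
  with inner_A[of ?A] inner_A[of ?B] inner_B[of ?B] inner_word_act[OF us] ab
  have eqs: "\<alpha> * \<alpha> + \<beta> * \<beta> + p * p = 1" "p * q = 0" "\<beta> * \<beta> + \<alpha> * \<alpha> + q * q = 1"
    by (simp_all add: norm_eq_1 defs)
  \<comment> \<open>The images of \<open>a\<close> and \<open>b\<close> are again orthonormal, which
    leaves \<open>p = q = 0\<close>: their plane is mapped to itself.\<close>
  then have "p * p = q * q" by linarith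
  with eqs(2) have pq: "p = 0" "q = 0" by auto
  have "word_act us (a \<times> b) = (\<alpha> *\<^sub>R a + \<beta> *\<^sub>R b) \<times> ((- \<beta>) *\<^sub>R a + \<alpha> *\<^sub>R b)"
    using A B pq by (simp flip: cross_word_act[OF us])
  also have "\<dots> = (\<alpha> * \<alpha> + \<beta> * \<beta>) *\<^sub>R (a \<times> b)"
    by (simp add: cross_add_left cross_add_right cross_mult_left cross_mult_right
        Cross3.right_diff_distrib cross_skew[of b a] algebra_simps)
  finally show ?thesis using eqs(1) pq by simp
qed


text \<open>Two fixed vectors that are not parallel would yield a whole frame fixed by the word, via
  cross products, and the word would fix \<open>w\<close> too.\<close>

lemma finite_fixed_axes:
  assumes us: "us \<in> lists sphere2" and w: "word_act us w \<noteq> w"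
  shows "finite {n \<in> sphere2. word_act us n = n}"
proof (cases "{n \<in> sphere2. word_act us n = n} = {}")
  case False
  then obtain n where n: "norm n = 1" "word_act us n = n"
    by (auto simp: sphere2_def)
  have "m \<in> {n, - n}" if m: "norm m = 1" "word_act us m = m" for m
  proof -
    have cross: "n \<times> m = 0"
    proof (rule ccontr)
      assume nz: "n \<times> m \<noteq> 0"
      define e where "e = sgn (n \<times> m)"
      have e: "norm e = 1" "n \<bullet> e = 0"
        using nz by (simp_all add: e_def norm_sgn sgn_div_norm dot_cross_self)
      have fix_e: "word_act us e = e"
        using cross_word_act[OF us, of n m] n m linear_scale[OF linear_word_act[of us]]
        by (simp add: e_def sgn_div_norm)
      have fix_ne: "word_act us (n \<times> e) = n \<times> e"
        using cross_word_act[OF us, of n e] n fix_e by simp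
      have "word_act us w = w"
        by (subst (1 2) frame_expansion[OF n(1) e, of w])
          (simp add: linear_add[OF linear_word_act] linear_scale[OF linear_word_act] n fix_e fix_ne)
      with w show False by simp
    qed
    have m_eq: "m = (n \<bullet> m) *\<^sub>R n"
      using Lagrange[of n n m] cross n(1) by (simp add: norm_eq_1)
    then have "norm m = \<bar>n \<bullet> m\<bar>"
      using n(1) by (metis mult.right_neutral norm_scaleR)
    with m have "n \<bullet> m = 1 \<or> n \<bullet> m = - 1" by linarith
    with m_eq show ?thesis by (metis insertCI scaleR_minus1_left scaleR_one)
  qed
  then have "{n \<in> sphere2. word_act us n = n} \<subseteq> {n, - n}"
    by (auto simp: sphere2_def)
  then show ?thesis by (rule finite_subset) simp
next
  case True
  then show ?thesis by (metis finite.emptyI)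
qed

subsection \<open>Words with a variable axis\<close>

text \<open>Reaches every line through the origin in the plane of \<open>a\<close> and
  \<open>b\<close> except that of \<open>b\<close>, and makes the half turn rational in
  \<open>t\<close>.\<close>

definition circle_point :: "real^3 \<Rightarrow> real^3 \<Rightarrow> real \<Rightarrow> real^3" where
  "circle_point a b t = (1 / sqrt (1 + t\<^sup>2)) *\<^sub>R (a + t *\<^sub>R b)"

text \<open>\<open>None\<close> marks the variable axis, so that one pattern yields a word for every
  \<open>u\<close>.\<close>

definition fill :: "real^3 \<Rightarrow> (real^3) option list \<Rightarrow> (real^3) list" where
  "fill u = map (case_option u id)"

lemma fill_simps [simp]:
  "fill u [] = []" "fill u (None # vs) = u # fill u vs" "fill u (Some v # vs) = v # fill u vs"
  by (simp_all add: fill_def)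

lemma one_plus_square_pos: "1 + t\<^sup>2 > (0::real)"
  by (simp add: add_pos_nonneg)

lemma norm_circle_point:
  assumes "norm a = 1" "norm b = 1" "a \<bullet> b = 0"
  shows "norm (circle_point a b t) = 1"
proof -
  have "(a + t *\<^sub>R b) \<bullet> (a + t *\<^sub>R b) = 1 + t\<^sup>2"
    using assms by (simp add: inner_add_left inner_add_right norm_eq_1 inner_commute power2_eq_square)
  then have "norm (a + t *\<^sub>R b) = sqrt (1 + t\<^sup>2)"
    by (simp add: norm_eq_sqrt_inner)
  then show ?thesis
    using one_plus_square_pos[of t] by (simp add: circle_point_def)
qed

text \<open>A half turn is quadratic in its axis, so the square roots cancel.\<close>

lemma half_turn_circle_point:
  "(1 + t\<^sup>2) *\<^sub>R half_turn (circle_point a b t) x =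
     (2 * ((a + t *\<^sub>R b) \<bullet> x)) *\<^sub>R (a + t *\<^sub>R b) - (1 + t\<^sup>2) *\<^sub>R x"
proof -
  let ?s = "sqrt (1 + t\<^sup>2)"
  have s: "?s * ?s = 1 + t\<^sup>2" "?s \<noteq> 0"
    using one_plus_square_pos[of t] by simp_all
  have "half_turn (circle_point a b t) x = (2 * ((a + t *\<^sub>R b) \<bullet> x) / (?s * ?s)) *\<^sub>R (a + t *\<^sub>R b) - x"
    by (simp add: half_turn_def circle_point_def)
  then show ?thesis
    using s one_plus_square_pos[of t] by (simp add: scaleR_diff_right)
qed

text \<open>The action of a word on \<open>w\<close>, where \<^const>\<open>None\<close> stands for the half turn about
  \<open>a + z b\<close>, multiplied by \<open>1 + z\<^sup>2\<close> so that it makes sense for every complex \<open>z\<close>.\<close>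
primrec complex_word ::
    "real^3 \<Rightarrow> real^3 \<Rightarrow> real^3 \<Rightarrow> complex \<Rightarrow> (real^3) option list \<Rightarrow> 3 \<Rightarrow> complex" where
  "complex_word a b w z [] = (\<lambda>i. of_real (w $ i))"
| "complex_word a b w z (v # vs) = (\<lambda>i. case v of
      None \<Rightarrow> 2 * (\<Sum>j\<in>UNIV. (of_real (a $ j) + z * of_real (b $ j)) * complex_word a b w z vs j)
                * (of_real (a $ i) + z * of_real (b $ i)) - (1 + z\<^sup>2) * complex_word a b w z vs i
    | Some v \<Rightarrow> 2 * (\<Sum>j\<in>UNIV. of_real (v $ j) * complex_word a b w z vs j) * of_real (v $ i)
                - complex_word a b w z vs i)"

lemma complex_word_of_real:
  "complex_word a b w (of_real t) vs i =
     of_real ((1 + t\<^sup>2) ^ count_list vs None * word_act (fill (circle_point a b t) vs) w $ i)"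
proof (induction vs arbitrary: i)
  case (Cons v vs)
  let ?x = "word_act (fill (circle_point a b t) vs) w"
  show ?case
  proof (cases v)
    case None
    let ?u = "a + t *\<^sub>R b"
    have "(1 + t\<^sup>2) * half_turn (circle_point a b t) ?x $ i
        = 2 * (?u \<bullet> ?x) * ?u $ i - (1 + t\<^sup>2) * ?x $ i"
      using arg_cong[OF half_turn_circle_point[of t a b ?x], of "\<lambda>y. y $ i"] by simp
    then have *: "(1 + t\<^sup>2) ^ count_list (v # vs) None * word_act (fill (circle_point a b t) (v # vs)) w $ i
        = (1 + t\<^sup>2) ^ count_list vs None * (2 * (?u \<bullet> ?x) * ?u $ i - (1 + t\<^sup>2) * ?x $ i)"
      by (simp add: None)
    show ?thesis
      unfolding * by (simp add: None Cons.IH inner_vec_def sum_3) (simp add: algebra_simps)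
  next
    case (Some u)
    then show ?thesis
      by (simp add: Cons.IH half_turn_def inner_vec_def sum_3) (simp add: algebra_simps)
  qed
qed simp

lemma complex_word_polynomial: "\<exists>p. \<forall>z. complex_word a b w z vs i = poly p z"
proof (induction vs arbitrary: i)
  case Nil
  show ?case by (rule exI[of _ "[:of_real (w $ i):]"]) simp
next
  case (Cons v vs)
  then obtain p where p: "\<And>j z. complex_word a b w z vs j = poly (p j) z" by metis
  show ?case
  proof (cases v)
    case None
    have "complex_word a b w z (v # vs) i =
        poly (2 * (\<Sum>j\<in>UNIV. [:of_real (a $ j), of_real (b $ j):] * p j)
          * [:of_real (a $ i), of_real (b $ i):] - [:1, 0, 1:] * p i) z" for z
      by (simp add: None p poly_sum sum_3 power2_eq_square) (simp add: algebra_simps)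
    then show ?thesis by blast
  next
    case (Some u)
    have "complex_word a b w z (v # vs) i =
        poly (2 * (\<Sum>j\<in>UNIV. [:of_real (u $ j):] * p j) * [:of_real (u $ i):] - p i) z" for z
      by (simp add: Some p poly_sum)
    then show ?thesis by blast
  qed
qed

text \<open>At \<open>\<i>\<close> each \<open>None\<close> maps \<open>x\<close> to a multiple of
  the isotropic vector \<open>a + \<i> b\<close>, so only the letters left of the first
  \<open>None\<close> still act on a vector. Everything to the right is collected in the scalar
  \<open>l\<close>.\<close>

lemma complex_word_at_ii:
  assumes U: "U \<subseteq> sphere2" and w: "norm w = 1"
    and ab: "norm a = 1" "norm b = 1" "a \<bullet> b = 0"
    and nfix: "\<And>us. \<lbrakk>us \<in> lists U; us \<noteq> []; distinct_adj us\<rbrakk> \<Longrightarrow> word_act us (a \<times> b) \<noteq> a \<times> b"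
    and off: "\<And>us. \<lbrakk>us \<in> lists U; distinct_adj us\<rbrakk> \<Longrightarrow> word_act us w \<notin> {a \<times> b, - (a \<times> b)}"
    and vs: "vs \<in> lists (insert None (Some ` U))" "distinct_adj vs"
  shows "if None \<in> set vs
    then \<exists>us vs' l. vs = map Some us @ None # vs' \<and> us \<in> lists U \<and> l \<noteq> 0 \<and>
      (\<forall>i. complex_word a b w \<i> vs i = l * Complex (word_act us a $ i) (word_act us b $ i))
    else \<exists>us. vs = map Some us \<and> us \<in> lists U \<and>
      (\<forall>i. complex_word a b w \<i> vs i = of_real (word_act us w $ i))"
  using vs
proof (induction vs rule: list.induct)
  case (Cons v vs)
  then have vs: "vs \<in> lists (insert None (Some ` U))" "distinct_adj vs"
    by (auto simp: distinct_adj_Cons)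
  note IH = Cons.IH[OF this]
  show ?case
  proof (cases v)
    case (Some u)
    with Cons.prems have u: "u \<in> U" by auto
    show ?thesis
    proof (cases "None \<in> set vs")
      case True
      with IH obtain us vs' l where
        *: "vs = map Some us @ None # vs'" "us \<in> lists U" "l \<noteq> 0"
           "\<And>i. complex_word a b w \<i> vs i = l * Complex (word_act us a $ i) (word_act us b $ i)"
        by auto
      have "complex_word a b w \<i> (v # vs) i
          = l * Complex (word_act (u # us) a $ i) (word_act (u # us) b $ i)" for i
        unfolding Some
        by (simp add: *(4) Complex_eq half_turn_def inner_vec_def sum_3) (simp add: algebra_simps)
      moreover have "v # vs = map Some (u # us) @ None # vs'" "u # us \<in> lists U"
        using * u Some by simp_all
      moreover have "None \<in> set (v # vs)" using True by simp
      ultimately show ?thesis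
        using \<open>l \<noteq> 0\<close> unfolding if_P[OF \<open>None \<in> set (v # vs)\<close>]
        by (intro exI[of _ "u # us"] exI[of _ vs'] exI[of _ l] conjI allI)
    next
      case False
      with IH obtain us where
        *: "vs = map Some us" "us \<in> lists U"
           "\<And>i. complex_word a b w \<i> vs i = of_real (word_act us w $ i)"
        by auto
      have "complex_word a b w \<i> (v # vs) i = of_real (word_act (u # us) w $ i)" for i
        unfolding Some
        by (simp add: *(3) half_turn_def inner_vec_def sum_3)
      moreover have "v # vs = map Some (u # us)" "u # us \<in> lists U"
        using * u Some by simp_all
      moreover have "None \<notin> set (v # vs)" using False Some by simp
      ultimately show ?thesis
        unfolding if_not_P[OF \<open>None \<notin> set (v # vs)\<close>] by (intro exI[of _ "u # us"] conjI allI)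
    qed
  next
    case None
    let ?d = "\<Sum>j\<in>UNIV. (of_real (a $ j) + \<i> * of_real (b $ j)) * complex_word a b w \<i> vs j"
    \<comment> \<open>The term with factor \<open>1 + z\<^sup>2\<close> vanishes at
      \<open>\<i>\<close>. The empty words give the shape of the claim with an empty prefix.\<close>
    have step: "complex_word a b w \<i> (v # vs) i
        = 2 * ?d * Complex (word_act [] a $ i) (word_act [] b $ i)" for i
      by (simp add: None Complex_eq)
    have "?d \<noteq> 0"
    proof (cases "None \<in> set vs")
      case True
      with IH obtain us vs' l where
        *: "vs = map Some us @ None # vs'" "us \<in> lists U" "l \<noteq> 0"
           "\<And>i. complex_word a b w \<i> vs i = l * Complex (word_act us a $ i) (word_act us b $ i)"
        by auto
      \<comment> \<open>\<open>us\<close> stands between two occurrences of \<open>None\<close>,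
        which cannot be adjacent.\<close>
      have us: "us \<noteq> []" "distinct_adj us" "us \<in> lists sphere2"
        using Cons.prems(2) * U vs unfolding None
        by (auto simp: distinct_adj_append_iff dest: distinct_adj_mapD)
      have d: "?d = l * Complex (a \<bullet> word_act us a - b \<bullet> word_act us b)
          (a \<bullet> word_act us b + b \<bullet> word_act us a)"
        by (simp add: *(4) Complex_eq inner_vec_def sum_3) (simp add: algebra_simps)
      show ?thesis
      proof
        assume "?d = 0"
        with d \<open>l \<noteq> 0\<close> have "Complex (a \<bullet> word_act us a - b \<bullet> word_act us b)
          (a \<bullet> word_act us b + b \<bullet> word_act us a) = 0" by simp
        then have "a \<bullet> word_act us a = b \<bullet> word_act us b"
            "a \<bullet> word_act us b = - (b \<bullet> word_act us a)"
          by (simp_all add: complex_eq_iff)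
        from isotropic_inner_zero_imp_fixed[OF us(3) ab this] nfix[OF *(2) us(1,2)]
        show False by simp
      qed
    next
      case False
      with IH obtain us where
        *: "vs = map Some us" "us \<in> lists U"
           "\<And>i. complex_word a b w \<i> vs i = of_real (word_act us w $ i)"
        by auto
      have us: "distinct_adj us" "us \<in> lists sphere2"
        using * U vs by (auto dest: distinct_adj_mapD)
      let ?x = "word_act us w"
      have d: "?d = Complex (a \<bullet> ?x) (b \<bullet> ?x)"
        by (simp add: *(3) Complex_eq inner_vec_def sum_3) (simp add: algebra_simps)
      show ?thesis
      proof
        assume "?d = 0"
        \<comment> \<open>A unit vector orthogonal to \<open>a\<close> and \<open>b\<close> is plus
          or minus \<open>a \<times> b\<close>, which \<open>off\<close> excludes.\<close>
        with d have "a \<bullet> ?x = 0" "b \<bullet> ?x = 0" by (simp_all add: complex_eq_iff)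
        with frame_expansion[OF ab, of ?x]
        have x: "?x = ((a \<times> b) \<bullet> ?x) *\<^sub>R (a \<times> b)" by simp
        have "norm ?x = 1" using norm_word_act[OF us(2)] w by simp
        moreover have "norm (a \<times> b) = 1"
          using norm_cross_dot[of a b] ab
          by (simp add: power2_eq_1_iff) (smt (verit) norm_ge_zero)
        ultimately have "\<bar>(a \<times> b) \<bullet> ?x\<bar> = 1"
          using x by (metis mult.right_neutral norm_scaleR)
        then have "(a \<times> b) \<bullet> ?x = 1 \<or> (a \<times> b) \<bullet> ?x = - 1" by linarith
        with x have "?x \<in> {a \<times> b, - (a \<times> b)}"
          by (metis insertCI scaleR_minus1_left scaleR_one)
        with off[OF *(2) us(1)] show False by simp
      qed
    qed
    moreover have "v # vs = map Some [] @ None # vs" "None \<in> set (v # vs)"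
      by (simp_all add: None)
    ultimately show ?thesis
      unfolding if_P[OF \<open>None \<in> set (v # vs)\<close>]
      by (intro exI[of _ "[]"] exI[of _ vs] exI[of _ "2 * ?d"] conjI allI step) simp_all
  qed
qed simp

text \<open>Infinitely many solutions would make a polynomial identity hold for all complex
  \<open>z\<close>; at \<open>\<i>\<close> it would say that a nonzero multiple of a rotated
  isotropic vector vanishes.\<close>

lemma finite_bad_parameters:
  assumes U: "U \<subseteq> sphere2" and w: "norm w = 1"
    and ab: "norm a = 1" "norm b = 1" "a \<bullet> b = 0"
    and nfix: "\<And>us. \<lbrakk>us \<in> lists U; us \<noteq> []; distinct_adj us\<rbrakk> \<Longrightarrow> word_act us (a \<times> b) \<noteq> a \<times> b"
    and off: "\<And>us. \<lbrakk>us \<in> lists U; distinct_adj us\<rbrakk> \<Longrightarrow> word_act us w \<notin> {a \<times> b, - (a \<times> b)}"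
    and vs: "vs \<in> lists (insert None (Some ` U))" "distinct_adj vs" "None \<in> set vs"
  shows "finite {t. word_act (fill (circle_point a b t) vs) w = w'}" (is "finite ?T")
proof (rule ccontr)
  assume inf: "infinite ?T"
  have zero: "complex_word a b w \<i> vs i = 0" for i
  proof -
    obtain p where p: "\<And>z. complex_word a b w z vs i = poly p z"
      using complex_word_polynomial by blast
    let ?q = "p - [:1, 0, 1:] ^ count_list vs None * [:of_real (w' $ i):]"
    have "poly ?q (of_real t) = 0" if "t \<in> ?T" for t
      using that complex_word_of_real[of a b w t vs i]
      by (simp add: p power2_eq_square)
    then have "of_real ` ?T \<subseteq> {z. poly ?q z = 0}" by auto
    moreover have "infinite (complex_of_real ` ?T)"
      using inf by (simp add: finite_image_iff inj_on_def)
    ultimately have "infinite {z. poly ?q z = 0}"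
      using finite_subset by blast
    then have "?q = 0" using poly_roots_finite by blast
    then have "poly ?q \<i> = 0" by simp
    \<comment> \<open>A positive exponent makes the power of \<open>1 + z\<^sup>2\<close> in front
      of \<open>w'\<close> vanish at \<open>\<i>\<close>.\<close>
    moreover have "count_list vs None \<noteq> 0"
      using vs(3) by (simp add: count_list_0_iff)
    ultimately show ?thesis by (simp add: p)
  qed
  have "\<exists>us vs' l. vs = map Some us @ None # vs' \<and> us \<in> lists U \<and> l \<noteq> 0 \<and>
      (\<forall>i. complex_word a b w \<i> vs i = l * Complex (word_act us a $ i) (word_act us b $ i))"
    using complex_word_at_ii[OF U w ab nfix off vs(1,2)] vs(3) by simp
  then obtain us l where us: "us \<in> lists U" "l \<noteq> 0"
    "\<And>i. complex_word a b w \<i> vs i = l * Complex (word_act us a $ i) (word_act us b $ i)"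
    by blast
  with zero have "word_act us a $ i = 0" for i
    by (metis complex.sel(1) mult_eq_0_iff zero_complex.sel(1))
  then have "word_act us a = 0" by (simp add: vec_eq_iff)
  moreover have "us \<in> lists sphere2" using us U by auto
  ultimately show False using norm_word_act[of us a] ab by simp
qed

subsection \<open>Free sets of axes\<close>

unbundle no cross3_syntax

text \<open>\<open>distinct_adj\<close> expresses reducedness, as half turns are their own inverses.
  If \<open>W\<close> is nonempty, no nonempty reduced word is the identity.\<close>

definition free_axes :: "(real^3) set \<Rightarrow> (real^3) set \<Rightarrow> bool" where
  "free_axes W U \<longleftrightarrow> U \<subseteq> sphere2 \<and>
     (\<forall>us w. us \<in> lists U \<and> us \<noteq> [] \<and> distinct_adj us \<and> w \<in> W \<longrightarrow> word_act us w \<notin> W)"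

lemma free_axesD:
  "\<lbrakk>free_axes W U; us \<in> lists U; us \<noteq> []; distinct_adj us; w \<in> W\<rbrakk> \<Longrightarrow> word_act us w \<notin> W"
  by (simp add: free_axes_def)

lemma free_axes_maximal_exists:
  obtains U where "free_axes W U" "\<And>X. free_axes W X \<Longrightarrow> U \<subseteq> X \<Longrightarrow> X = U"
proof -
  have "\<exists>M\<in>Collect (free_axes W). \<forall>X\<in>Collect (free_axes W). M \<subseteq> X \<longrightarrow> X = M"
  proof (rule subset_Zorn_nonempty)
    show "Collect (free_axes W) \<noteq> {}"
      by (auto simp: free_axes_def intro!: exI[of _ "{}"])
    fix C assume C: "C \<noteq> {}" "subset.chain (Collect (free_axes W)) C"
    have free: "free_axes W X" if "X \<in> C" for X
      using C(2) that by (auto simp: subset.chain_def)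
    have "word_act us w \<notin> W" if us: "us \<in> lists (\<Union>C)" "us \<noteq> []" "distinct_adj us" "w \<in> W" for us w
    proof -
      \<comment> \<open>A word has finitely many letters, so they all lie in one member of the
        chain.\<close>
      have "set us \<subseteq> \<Union>C" using us by auto
      then obtain X where "X \<in> C" "set us \<subseteq> X"
        using finite_subset_Union_chain[OF _ _ C] by (metis List.finite_set)
      then have "us \<in> lists X" by auto
      from free_axesD[OF free[OF \<open>X \<in> C\<close>] this us(2-4)] show ?thesis .
    qed
    moreover have "\<Union>C \<subseteq> sphere2" using free by (auto simp: free_axes_def)
    ultimately show "\<Union>C \<in> Collect (free_axes W)" by (auto simp: free_axes_def)
  qed
  then show ?thesis using that by auto
qed

lemma inj_circle_point:
  assumes "norm a = 1" "norm b = 1" "a \<bullet> b = 0"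
  shows "inj (circle_point a b)"
proof (rule injI)
  fix s t assume eq: "circle_point a b s = circle_point a b t"
  have in_a: "a \<bullet> circle_point a b t = 1 / sqrt (1 + t\<^sup>2)" for t
    using assms by (simp add: circle_point_def inner_add_right norm_eq_1)
  have in_b: "b \<bullet> circle_point a b t = t / sqrt (1 + t\<^sup>2)" for t
    using assms by (simp add: circle_point_def inner_add_right norm_eq_1 inner_commute)
  have pos: "sqrt (1 + t\<^sup>2) > 0" for t :: real
    using one_plus_square_pos by simp
  have "sqrt (1 + s\<^sup>2) = sqrt (1 + t\<^sup>2)"
    using in_a[of s] in_a[of t] eq by simp
  then have "s / sqrt (1 + t\<^sup>2) = t / sqrt (1 + t\<^sup>2)"
    using in_b[of s] in_b[of t] eq by metis
  with pos[of t] show "s = t" by (metis divide_cancel_right less_irrefl)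
qed

lemma real_lepoll_sphere2: "(UNIV :: real set) \<lesssim> sphere2"
proof -
  have f: "norm (axis 1 1 :: real^3) = 1" "norm (axis 2 1 :: real^3) = 1"
    "(axis 1 1 :: real^3) \<bullet> axis 2 1 = 0"
    by (simp_all add: inner_axis_axis)
  show ?thesis
    unfolding lepoll_def
    using inj_circle_point[OF f] norm_circle_point[OF f] by (auto simp: sphere2_def)
qed

text \<open>Each word excludes finitely many vectors by its fixed points and countably many by the
  images of \<open>W\<close>; fewer than continuum many are excluded in total.\<close>

lemma generic_axis_exists:
  assumes U: "free_axes W U" and W: "W \<subseteq> sphere2" "countable W" "W \<noteq> {}"
    and card: "\<not> (UNIV :: real set) \<lesssim> U"
  obtains n where "norm n = 1"
    "\<And>us. \<lbrakk>us \<in> lists U; us \<noteq> []; distinct_adj us\<rbrakk> \<Longrightarrow> word_act us n \<noteq> n"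
    "\<And>us w. \<lbrakk>us \<in> lists U; w \<in> W\<rbrakk> \<Longrightarrow> word_act us w \<notin> {n, - n}"
proof -
  define X where "X = (\<Union>us \<in> {us \<in> lists U. us \<noteq> [] \<and> distinct_adj us}. {n \<in> sphere2. word_act us n = n})"
  define Y where "Y = (\<Union>(us, w) \<in> lists U \<times> W. {word_act us w, - word_act us w})"
  obtain w where "w \<in> W" using W by blast
  have lists_U: "lists U \<subseteq> lists sphere2" using U by (auto simp: free_axes_def)
  have "small U X"
    unfolding X_def
  proof (rule small_UN)
    show "small U {us \<in> lists U. us \<noteq> [] \<and> distinct_adj us}"
      by (rule small_subset[OF small_lists[OF small_self]]) auto
    fix us assume us: "us \<in> {us \<in> lists U. us \<noteq> [] \<and> distinct_adj us}"
    \<comment> \<open>Freeness moves \<open>w\<close> out of \<open>W\<close>, so the word is not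
      the identity.\<close>
    then have "word_act us w \<noteq> w" using free_axesD[OF U, of us w] \<open>w \<in> W\<close> by force
    then show "small U {n \<in> sphere2. word_act us n = n}"
      using us lists_U by (intro small_countable countable_finite finite_fixed_axes) auto
  qed
  moreover have "small U Y"
    unfolding Y_def
    by (intro small_UN small_Times small_lists small_self small_countable W) auto
  ultimately have "small U (X \<union> Y)" by (rule small_Un)
  moreover have "\<not> small U sphere2"
    using card small_real_imp_lepoll[of U] real_lepoll_sphere2 lepoll_trans
    unfolding small_def by blast
  ultimately obtain n where n: "n \<in> sphere2" "n \<notin> X" "n \<notin> Y"
    using small_subset by blast
  show ?thesis
  proof (rule that[of n])
    show "norm n = 1" using n by (simp add: sphere2_def)
    show "word_act us n \<noteq> n" if "us \<in> lists U" "us \<noteq> []" "distinct_adj us" for us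
      using n that by (auto simp: X_def)
    show "word_act us w \<notin> {n, - n}" if "us \<in> lists U" "w \<in> W" for us w
      using n(3) that by (force simp: Y_def)
  qed
qed

text \<open>Every pattern containing the new axis and every pair of points of \<open>W\<close> rule
  out finitely many parameters, so some \<open>t\<close> survives.\<close>

lemma free_axes_extend:
  assumes U: "free_axes W U" and W: "W \<subseteq> sphere2" "countable W" "W \<noteq> {}"
    and card: "\<not> (UNIV :: real set) \<lesssim> U"
  obtains u where "u \<notin> U" "free_axes W (insert u U)"
proof -
  have U_sphere: "U \<subseteq> sphere2" using U by (simp add: free_axes_def)
  obtain n where n: "norm n = 1"
    "\<And>us. \<lbrakk>us \<in> lists U; us \<noteq> []; distinct_adj us\<rbrakk> \<Longrightarrow> word_act us n \<noteq> n"
    "\<And>us w. \<lbrakk>us \<in> lists U; w \<in> W\<rbrakk> \<Longrightarrow> word_act us w \<notin> {n, - n}"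
    using generic_axis_exists[OF assms] by blast
  obtain a b where ab: "norm a = 1" "norm b = 1" "a \<bullet> b = 0" and n_eq: "cross3 a b = n"
    using orthonormal_frame_exists[OF n(1)] by blast
  let ?V = "{vs \<in> lists (insert None (Some ` U)). distinct_adj vs \<and> None \<in> set vs}"
  define T where "T = (\<Union>(vs, w, w') \<in> ?V \<times> W \<times> W.
    {t. word_act (fill (circle_point a b t) vs) w = w'})"
  have "small U (insert None (Some ` U))"
    using small_Un[OF small_countable[of "{None}"] small_image[OF small_self]] by simp
  then have "small U ?V"
    by (rule small_subset[OF small_lists]) auto
  then have index: "small U (?V \<times> W \<times> W)"
    by (intro small_Times small_countable[OF W(2)])
  have "small U T"
    unfolding T_def
  proof (rule small_UN[OF index], rule small_countable)
    fix x assume "x \<in> ?V \<times> W \<times> W"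
    then obtain vs w w' where x: "x = (vs, w, w')" "vs \<in> lists (insert None (Some ` U))"
      "distinct_adj vs" "None \<in> set vs" "w \<in> W" by auto
    then have "norm w = 1" using W by (auto simp: sphere2_def)
    then have "finite {t. word_act (fill (circle_point a b t) vs) w = w'}"
      using finite_bad_parameters[OF U_sphere _ ab, of w vs w'] n x unfolding n_eq by blast
    then show "countable (case x of (vs, w, w') \<Rightarrow> {t. word_act (fill (circle_point a b t) vs) w = w'})"
      by (simp add: x countable_finite)
  qed
  then have "T \<noteq> UNIV"
    using card small_real_imp_lepoll by blast
  then obtain t where t: "t \<notin> T" by blast
  define u where "u = circle_point a b t"
  have u: "norm u = 1" unfolding u_def by (rule norm_circle_point[OF ab])
  have avoid: "word_act (fill u vs) w \<notin> W" if "vs \<in> ?V" "w \<in> W" for vs w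
    using t that unfolding T_def u_def by blast
  have "u \<notin> U"
  proof
    assume "u \<in> U"
    moreover obtain w where "w \<in> W" using W by blast
    \<comment> \<open>The pattern \<open>[None, Some u]\<close> is reduced, yet filling it with
      \<open>u\<close> gives the identity.\<close>
    ultimately show False
      using avoid[of "[None, Some u]" w] by (simp add: half_turn_involution[OF u])
  qed
  moreover have "word_act us w \<notin> W"
    if us: "us \<in> lists (insert u U)" "us \<noteq> []" "distinct_adj us" and w: "w \<in> W" for us w
  proof (cases "u \<in> set us")
    case True
    \<comment> \<open>Turns a word back into its pattern; injectivity keeps it reduced.\<close>
    let ?f = "\<lambda>x. if x = u then None else Some x"
    have "fill u (map ?f us) = us"
      unfolding fill_def by (simp add: map_idI)
    moreover have "map ?f us \<in> ?V"
    proof (intro CollectI conjI)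
      show "map ?f us \<in> lists (insert None (Some ` U))"
        using us(1) by (fastforce simp: in_lists_conv_set)
      show "distinct_adj (map ?f us)"
        using us(3) by (auto intro!: distinct_adj_mapI simp: inj_on_def split: if_splits)
      show "None \<in> set (map ?f us)"
        using True by force
    qed
    ultimately show ?thesis using avoid[OF _ w, of "map ?f us"] by simp
  next
    case False
    then have "us \<in> lists U" using us by auto
    then show ?thesis using free_axesD[OF U] us w by blast
  qed
  ultimately show ?thesis
    using that[of u] u U_sphere by (auto simp: free_axes_def sphere2_def)
qed

lemma continuum_free_axes_exist:
  assumes "W \<subseteq> sphere2" "countable W" "W \<noteq> {}"
  obtains U where "free_axes W U" "(UNIV :: real set) \<lesssim> U"
proof -
  obtain U where U: "free_axes W U" "\<And>X. free_axes W X \<Longrightarrow> U \<subseteq> X \<Longrightarrow> X = U"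
    using free_axes_maximal_exists by blast
  then show ?thesis
    using free_axes_extend[OF U(1) assms] that by (metis insertI1 subset_insertI)
qed

section \<open>The precolouring and the symmetry of its extensions\<close>

lemma precolouring_exists:
  assumes W: "W \<subseteq> sphere2" "countable W" "W \<noteq> {}"
  shows "\<exists>c. \<forall>f. extends_precol f W c \<longrightarrow> \<not> SO3_distinguishing f"
proof -
  obtain U where U: "free_axes W U" "(UNIV :: real set) \<lesssim> U"
    using continuum_free_axes_exist[OF W] by blast
  obtain g :: "real^3 \<Rightarrow> nat" where g: "inj_on g W"
    using W(2) by (auto simp: countable_def)
  \<comment> \<open>A countable set has at most continuum many subsets, so each one can receive its
    own axis.\<close>
  have "inj_on ((`) g) (Pow W)"
    using g by (rule inj_on_image_Pow)
  then have "Pow W \<lesssim> (UNIV :: nat set set)"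
    unfolding lepoll_def by blast
  also have "\<dots> \<lesssim> (UNIV :: real set)"
    using nat_sets_eqpoll_reals by (rule eqpoll_imp_lepoll)
  also note U(2)
  finally obtain \<phi> where \<phi>: "inj_on \<phi> (Pow W)" "\<phi> ` Pow W \<subseteq> U"
    by (auto simp: lepoll_def)
  \<comment> \<open>Axes outside the range of \<open>\<phi>\<close> get an unspecified set; only the
    value at the axis of \<open>S\<close> matters below.\<close>
  define \<psi> where "\<psi> = inv_into (Pow W) \<phi>"
  define red where "red x \<longleftrightarrow> (\<exists>us w. us \<in> lists U \<and> us \<noteq> [] \<and> distinct_adj us \<and> w \<in> W \<and>
      w \<in> \<psi> (last us) \<and> x = word_act us w)" for x
  \<comment> \<open>Freeness enters here: it keeps the red points prescribed by words away from
    \<open>W\<close>.\<close>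
  have red_W: "x \<notin> W" if "red x" for x
    using that U(1) by (auto simp: red_def free_axes_def)
  have "\<not> SO3_distinguishing f" if f: "extends_precol f W (\<lambda>x. if red x then R else B)" for f
  proof -
    define S where "S = {w \<in> W. f w = R}"
    define u where "u = \<phi> S"
    have S: "S \<subseteq> W" "S \<in> Pow W" by (auto simp: S_def)
    have "u \<in> U" using \<phi>(2) S by (auto simp: u_def)
    then have u: "norm u = 1" using U(1) by (auto simp: free_axes_def sphere2_def)
    have \<psi>_u: "\<psi> u = S" using \<phi>(1) S by (simp add: \<psi>_def u_def)
    have f_R: "f x = R \<longleftrightarrow> x \<in> S \<or> red x" if "x \<in> sphere2" for x
      using f that red_W[of x] by (cases "x \<in> W") (auto simp: extends_precol_def S_def)
    have step: "half_turn u x \<in> S \<or> red (half_turn u x)" if x: "x \<in> S \<or> red x" for x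
    proof (cases "x \<in> S")
      case True
      then have "red (half_turn u x)"
        unfolding red_def using S \<psi>_u \<open>u \<in> U\<close> by (intro exI[of _ "[u]"] exI[of _ x]) auto
      then show ?thesis ..
    next
      case False
      with x obtain us w where us: "us \<in> lists U" "us \<noteq> []" "distinct_adj us" "w \<in> W"
        "w \<in> \<psi> (last us)" "x = word_act us w" by (auto simp: red_def)
      show ?thesis
      proof (cases "hd us = u")
        case True
        then obtain us' where us': "us = u # us'" using us(2) by (metis list.collapse)
        then have hx: "half_turn u x = word_act us' w"
          using us half_turn_involution[OF u] by simp
        show ?thesis
        proof (cases "us' = []")
          case True
          \<comment> \<open>The word was just \<open>u\<close>, so the half turn returns to
            \<open>w\<close>, which lies in \<open>S\<close> because
            \<open>\<psi> u = S\<close>.\<close>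
          then show ?thesis using us us' hx \<psi>_u by simp
        next
          case False
          then have "red (half_turn u x)"
            unfolding red_def hx using us us' by (intro exI[of _ us'] exI[of _ w]) (auto simp: distinct_adj_Cons)
          then show ?thesis ..
        qed
      next
        case False
        then have "red (half_turn u x)"
          unfolding red_def using us \<open>u \<in> U\<close>
          by (intro exI[of _ "u # us"] exI[of _ w]) (auto simp: distinct_adj_Cons)
        then show ?thesis ..
      qed
    qed
    have "f (half_turn u x) = f x" if x: "x \<in> sphere2" for x
    proof -
      have "half_turn u x \<in> sphere2"
        using x norm_word_act[of "[u]" x] u by (simp add: sphere2_def)
      \<comment> \<open>Applying \<open>step\<close> to the image as well gives the converse, by
        involution.\<close>
      then have "f (half_turn u x) = R \<longleftrightarrow> f x = R"
        using f_R x step[of x] step[of "half_turn u x"] half_turn_involution[OF u] by auto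
      then show ?thesis by (metis colour.exhaust)
    qed
    then show ?thesis
      unfolding SO3_distinguishing_def
      using matrix_half_turn_in_SO3[OF u] matrix_half_turn_ne_id[OF u]
      by (metis matrix_half_turn_apply)
  qed
  then show ?thesis by blast
qed

theorem theorem4:
  fixes W :: "(real^3) set"
  assumes "W \<subseteq> sphere2" and "countable W"
  shows "(\<exists>c. \<forall>f. extends_precol f W c \<longrightarrow> \<not> SO3_distinguishing f) \<and> \<not> P_SO3 W"
proof -
  \<comment> \<open>The extra point makes the set nonempty, and an extension off \<open>W\<close> is
    also one off the larger \<open>W'\<close>.\<close>
  define W' where "W' = insert (axis 1 1) W"
  have "W' \<subseteq> sphere2" "countable W'" "W' \<noteq> {}"
    using assms by (auto simp: W'_def sphere2_def norm_axis_1)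
  then obtain c where c: "\<And>f. extends_precol f W' c \<Longrightarrow> \<not> SO3_distinguishing f"
    using precolouring_exists by blast
  then have "\<not> SO3_distinguishing f" if "extends_precol f W c" for f
    using that by (auto simp: extends_precol_def W'_def)
  then show ?thesis by (auto simp: P_SO3_def)
qed

end
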